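(* For $n, k \in \mathbb{N}$ with $k > 1$, $$|\mathcal{A}_{n+k}| = \sum_{\substack{\alpha,\beta \in \mathcal{A}_n\\ \alpha \le \beta}} |[\bot,\alpha]|\;\mathcal{P}_{n,k,\alpha,\beta}\;|[\beta,\top]|,$$ where the intervals are intervals in $\mathcal{A}_n$.
   Context: For a finite set $N$, $\mathcal{A}_N$ denotes the set of antichains in $N$: sets $\alpha \subseteq 2^N$ such that no two distinct members of $\alpha$ are in a subset/superset relationship; $\mathcal{A}_n=\mathcal{A}_{\{1,\ldots,n\}}$. Order: $\alpha \le \beta$ iff for every $A \in \alpha$ there is $B \in \beta$ with $A \subseteq B$. Join and meet: $\alpha\vee\beta=\max(\alpha\cup\beta)$, $\alpha\wedge\beta=\max\{A\cap B : A\in\alpha,B\in\beta\}$, where $\max$ of a set of sets keeps only the inclusion-maximal sets. In $\mathcal{A}_n$, $\bot=\{\}$ and $\top=\{\{1,\ldots,n\}\}$. Intervals: $[\alpha,\beta]=\{\chi : \alpha\le\chi\le\beta\}$. P-coefficients: for $n,k\in\mathbb{N}$ and $\rho_1,\rho_2\in\mathcal{A}_n$, let $K=\{n+1,\ldots,n+k\}$. Then $\mathcal{P}_{n,k,\rho_1,\rho_2}$ is the number of tuples $(\chi_P\in\mathcal{A}_n : P\subseteq K)$ satisfying simultaneously $\chi_\emptyset=\rho_2$; $\chi_K=\rho_1$; $\bigwedge_{i\in K}\chi_{K\setminus\{i\}}=\rho_1$; $\bigvee_{i\in K}\chi_{\{i\}}=\rho_2$; and $\chi_P\ge\chi_{P'}$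 whenever $P\subseteq P'\subseteq K$. *)

theory Defs
  imports "HOL-Library.FuncSet"
begin

definition antichains :: "'a set \<Rightarrow> 'a set set set" where
  "antichains N = {\<alpha>. \<alpha> \<subseteq> Pow N \<and> (\<forall>A\<in>\<alpha>. \<forall>B\<in>\<alpha>. A \<subseteq> B \<longrightarrow> A = B)}"

definition ac_le :: "'a set set \<Rightarrow> 'a set set \<Rightarrow> bool" (infix "\<preceq>" 50) where
  "\<alpha> \<preceq> \<beta> \<longleftrightarrow> (\<forall>A\<in>\<alpha>. \<exists>B\<in>\<beta>. A \<subseteq> B)"

definition max_sets :: "'a set set \<Rightarrow> 'a set set" where
  "max_sets S = {A \<in> S. \<forall>B\<in>S. A \<subseteq> B \<longrightarrow> A = B}"

definition ac_join :: "'a set set \<Rightarrow> 'a set set \<Rightarrow> 'a set set" where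
  "ac_join \<alpha> \<beta> = max_sets (\<alpha> \<union> \<beta>)"

definition ac_meet :: "'a set set \<Rightarrow> 'a set set \<Rightarrow> 'a set set" where
  "ac_meet \<alpha> \<beta> = max_sets {A \<inter> B |A B. A \<in> \<alpha> \<and> B \<in> \<beta>}"

definition ac_bot :: "'a set set" where
  "ac_bot = {}"

definition ac_top :: "'a set \<Rightarrow> 'a set set" where
  "ac_top N = {N}"

text \<open>The iterated join and meet of a finite family of antichains in \<open>N\<close>. The empty join and
  meet are the bottom and top of \<^term>\<open>antichains N\<close>; the order of iteration is immaterial, since
  the results are the least upper and greatest lower bound (\<open>ac_JOIN_lub\<close>, \<open>ac_MEET_glb\<close> below).\<close>

definition ac_JOIN :: "'i::linorder set \<Rightarrow> ('i \<Rightarrow> 'a set set) \<Rightarrow> 'a set set" where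
  "ac_JOIN I f = foldr (\<lambda>i. ac_join (f i)) (sorted_list_of_set I) ac_bot"

definition ac_MEET :: "'a set \<Rightarrow> 'i::linorder set \<Rightarrow> ('i \<Rightarrow> 'a set set) \<Rightarrow> 'a set set" where
  "ac_MEET N I f = foldr (\<lambda>i. ac_meet (f i)) (sorted_list_of_set I) (ac_top N)"

definition ac_interval :: "'a set \<Rightarrow> 'a set set \<Rightarrow> 'a set set \<Rightarrow> 'a set set set" where
  "ac_interval N \<alpha> \<beta> = {\<chi> \<in> antichains N. \<alpha> \<preceq> \<chi> \<and> \<chi> \<preceq> \<beta>}"

text \<open>Tuples indexed by the subsets of \<open>K\<close> are extensional functions on \<^term>\<open>Pow K\<close>.\<close>

definition P_coeff :: "nat \<Rightarrow> nat \<Rightarrow> nat set set \<Rightarrow> nat set set \<Rightarrow> nat" where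
  "P_coeff n k \<rho>\<^sub>1 \<rho>\<^sub>2 = (let K = {n+1..n+k} in
     card {\<chi> \<in> Pow K \<rightarrow>\<^sub>E antichains {1..n}.
       \<chi> {} = \<rho>\<^sub>2 \<and> \<chi> K = \<rho>\<^sub>1 \<and>
       ac_MEET {1..n} K (\<lambda>i. \<chi> (K - {i})) = \<rho>\<^sub>1 \<and>
       ac_JOIN K (\<lambda>i. \<chi> {i}) = \<rho>\<^sub>2 \<and>
       (\<forall>P P'. P \<subseteq> P' \<and> P' \<subseteq> K \<longrightarrow> \<chi> P' \<preceq> \<chi> P)})"

lemma ac_le_trans: "\<alpha> \<preceq> \<beta> \<Longrightarrow> \<beta> \<preceq> \<gamma> \<Longrightarrow> \<alpha> \<preceq> \<gamma>"
  unfolding ac_le_def by (meson subset_trans)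

lemma ac_le_antisym:
  assumes "\<alpha> \<in> antichains N" "\<beta> \<in> antichains N" "\<alpha> \<preceq> \<beta>" "\<beta> \<preceq> \<alpha>"
  shows "\<alpha> = \<beta>"
proof -
  have "\<alpha>' \<subseteq> \<beta>'"
    if h: "\<alpha>' \<in> antichains N" "\<alpha>' \<preceq> \<beta>'" "\<beta>' \<preceq> \<alpha>'" for \<alpha>' \<beta>'
  proof
    fix A assume A: "A \<in> \<alpha>'"
    then obtain B where B: "B \<in> \<beta>'" "A \<subseteq> B"
      using h(2) unfolding ac_le_def by blast
    then obtain C where C: "C \<in> \<alpha>'" "B \<subseteq> C"
      using h(3) unfolding ac_le_def by blast
    have "A \<subseteq> C" using B(2) C(2) by (rule subset_trans)
    then have "A = C"
      using h(1) A C(1) unfolding antichains_def by simp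
    then show "A \<in> \<beta>'" using B C by simp
  qed
  then show ?thesis using assms by (simp add: subset_antisym)
qed

lemma finite_antichain: "finite N \<Longrightarrow> \<alpha> \<in> antichains N \<Longrightarrow> finite \<alpha>"
  unfolding antichains_def by (auto intro: finite_subset[of _ "Pow N"])

lemma max_sets_antichain: "S \<subseteq> Pow N \<Longrightarrow> max_sets S \<in> antichains N"
  unfolding max_sets_def antichains_def by auto

lemma max_sets_dominates:
  assumes "finite S" "A \<in> S"
  shows "\<exists>B\<in>max_sets S. A \<subseteq> B"
  using finite_has_maximal2[OF assms] unfolding max_sets_def by auto

lemma ac_join_closed:
  "\<alpha> \<in> antichains N \<Longrightarrow> \<beta> \<in> antichains N \<Longrightarrow> ac_join \<alpha> \<beta> \<in> antichains N"
  unfolding ac_join_def by (rule max_sets_antichain) (auto simp: antichains_def)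

lemma ac_meet_closed:
  "\<alpha> \<in> antichains N \<Longrightarrow> \<beta> \<in> antichains N \<Longrightarrow> ac_meet \<alpha> \<beta> \<in> antichains N"
  unfolding ac_meet_def by (rule max_sets_antichain) (auto simp: antichains_def)

lemma ac_join_le_iff:
  assumes "finite N" "\<alpha> \<in> antichains N" "\<beta> \<in> antichains N"
  shows "ac_join \<alpha> \<beta> \<preceq> \<gamma> \<longleftrightarrow> \<alpha> \<preceq> \<gamma> \<and> \<beta> \<preceq> \<gamma>"
proof -
  have fin: "finite (\<alpha> \<union> \<beta>)"
    using assms finite_antichain by auto
  have "\<alpha> \<preceq> ac_join \<alpha> \<beta>" "\<beta> \<preceq> ac_join \<alpha> \<beta>"
    using max_sets_dominates[OF fin] by (simp_all add: ac_le_def ac_join_def)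
  moreover have "ac_join \<alpha> \<beta> \<preceq> \<gamma>" if "\<alpha> \<preceq> \<gamma>" "\<beta> \<preceq> \<gamma>"
    using that unfolding ac_le_def ac_join_def max_sets_def by blast
  ultimately show ?thesis
    by (meson ac_le_trans)
qed

lemma le_ac_meet_iff:
  assumes "finite N" "\<alpha> \<in> antichains N" "\<beta> \<in> antichains N"
  shows "\<gamma> \<preceq> ac_meet \<alpha> \<beta> \<longleftrightarrow> \<gamma> \<preceq> \<alpha> \<and> \<gamma> \<preceq> \<beta>"
proof -
  let ?S = "{A \<inter> B |A B. A \<in> \<alpha> \<and> B \<in> \<beta>}"
  have fin: "finite ?S"
    using finite_antichain[OF assms(1,2)] finite_antichain[OF assms(1,3)]
    by (intro finite_image_set2) simp_all
  have "ac_meet \<alpha> \<beta> \<preceq> \<alpha>" "ac_meet \<alpha> \<beta> \<preceq> \<beta>"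
    unfolding ac_le_def ac_meet_def max_sets_def by blast+
  moreover have "\<gamma> \<preceq> ac_meet \<alpha> \<beta>" if h: "\<gamma> \<preceq> \<alpha>" "\<gamma> \<preceq> \<beta>"
    unfolding ac_le_def
  proof
    fix C assume "C \<in> \<gamma>"
    then obtain A B where AB: "A \<in> \<alpha>" "B \<in> \<beta>" "C \<subseteq> A" "C \<subseteq> B"
      using h unfolding ac_le_def by blast
    have "A \<inter> B \<in> ?S" using AB(1,2) by blast
    then obtain D where D: "D \<in> ac_meet \<alpha> \<beta>" "A \<inter> B \<subseteq> D"
      using max_sets_dominates[OF fin, of "A \<inter> B"] by (auto simp only: ac_meet_def)
    have "C \<subseteq> D" using AB(3,4) D(2) by (meson Int_greatest subset_trans)
    then show "\<exists>D\<in>ac_meet \<alpha> \<beta>. C \<subseteq> D" using D(1) by (rule bexI)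
  qed
  ultimately show ?thesis
    by (meson ac_le_trans)
qed

lemma ac_JOIN_lub:
  assumes "finite N" "finite I" "\<And>i. i \<in> I \<Longrightarrow> f i \<in> antichains N"
  shows "ac_JOIN I f \<in> antichains N" "ac_JOIN I f \<preceq> \<gamma> \<longleftrightarrow> (\<forall>i\<in>I. f i \<preceq> \<gamma>)"
proof -
  have "foldr (\<lambda>i. ac_join (f i)) xs ac_bot \<in> antichains N \<and>
    (foldr (\<lambda>i. ac_join (f i)) xs ac_bot \<preceq> \<gamma> \<longleftrightarrow> (\<forall>i\<in>set xs. f i \<preceq> \<gamma>))"
    if "set xs \<subseteq> I" for xs
    using that
  proof (induction xs)
    case Nil
    show ?case by (simp add: ac_bot_def antichains_def ac_le_def)
  next
    case (Cons x xs)
    then show ?case using assms by (simp add: ac_join_closed ac_join_le_iff[of N])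
  qed
  from this[of "sorted_list_of_set I"] assms(2)
  show "ac_JOIN I f \<in> antichains N" "ac_JOIN I f \<preceq> \<gamma> \<longleftrightarrow> (\<forall>i\<in>I. f i \<preceq> \<gamma>)"
    by (simp_all add: ac_JOIN_def)
qed

lemma ac_MEET_glb:
  assumes "finite N" "finite I" "\<And>i. i \<in> I \<Longrightarrow> f i \<in> antichains N"
  shows "ac_MEET N I f \<in> antichains N"
    and "\<gamma> \<in> antichains N \<Longrightarrow> \<gamma> \<preceq> ac_MEET N I f \<longleftrightarrow> (\<forall>i\<in>I. \<gamma> \<preceq> f i)"
proof -
  have *: "foldr (\<lambda>i. ac_meet (f i)) xs (ac_top N) \<in> antichains N \<and>
    (\<gamma> \<in> antichains N \<longrightarrow>
      (\<gamma> \<preceq> foldr (\<lambda>i. ac_meet (f i)) xs (ac_top N) \<longleftrightarrow> (\<forall>i\<in>set xs. \<gamma> \<preceq> f i)))"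
    if "set xs \<subseteq> I" for xs
    using that
  proof (induction xs)
    case Nil
    show ?case by (auto simp: ac_top_def antichains_def ac_le_def)
  next
    case (Cons x xs)
    then show ?case using assms by (simp add: ac_meet_closed le_ac_meet_iff[of N])
  qed
  from *[of "sorted_list_of_set I"] assms(2)
  show "ac_MEET N I f \<in> antichains N"
    and "\<gamma> \<in> antichains N \<Longrightarrow> \<gamma> \<preceq> ac_MEET N I f \<longleftrightarrow> (\<forall>i\<in>I. \<gamma> \<preceq> f i)"
    by (simp_all add: ac_MEET_def)
qed

end

theory Submission
  imports Defs
begin

text \<open>Slicing the down-set generated by an antichain in \<open>N \<union> K\<close> along the subsets of \<open>K\<close> identifies
  antichains in \<open>N \<union> K\<close> with antitone families \<open>\<psi>\<close> of antichains in \<open>N\<close> indexed by \<^term>\<open>Pow K\<close>.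
  Put \<open>\<alpha> = \<And>\<^sub>i \<psi> (K - {i})\<close> and \<open>\<beta> = \<Or>\<^sub>i \<psi> {i}\<close>. Antitonicity constrains the two extreme
  members only by \<open>\<psi> K \<preceq> \<alpha>\<close> and \<open>\<beta> \<preceq> \<psi> {}\<close>, and overwriting them by \<open>\<alpha>\<close> and \<open>\<beta>\<close> gives one
  of the tuples counted by the coefficient of \<open>(\<alpha>, \<beta>)\<close>. As \<open>K\<close> has two elements \<open>i \<noteq> j\<close>,
  neither \<open>\<alpha>\<close> nor \<open>\<beta>\<close> depends on the extreme members, and
  \<open>\<alpha> \<preceq> \<psi> (K - {i}) \<preceq> \<psi> {j} \<preceq> \<beta>\<close>.\<close>

section \<open>Antichains described through the down-sets they generate\<close>

lemma ac_le_refl: "\<alpha> \<preceq> \<alpha>"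
  unfolding ac_le_def by blast

lemma finite_antichains: "finite N \<Longrightarrow> finite (antichains N)"
  by (rule finite_subset[of _ "Pow (Pow N)"]) (auto simp: antichains_def)

text \<open>\<open>{X} \<preceq> \<alpha>\<close> serves throughout as the membership test for the
  down-set generated by \<alpha>, so down-sets never need a notation of their own.\<close>

lemma singleton_le_iff: "{X} \<preceq> \<alpha> \<longleftrightarrow> (\<exists>A\<in>\<alpha>. X \<subseteq> A)"
  by (simp add: ac_le_def)

lemma singleton_le_mono: "{X} \<preceq> \<alpha> \<Longrightarrow> Y \<subseteq> X \<Longrightarrow> {Y} \<preceq> \<alpha>"
  unfolding singleton_le_iff by (meson subset_trans)

lemma singleton_le_max_sets_iff:
  assumes "finite S"
  shows "{X} \<preceq> max_sets S \<longleftrightarrow> (\<exists>B\<in>S. X \<subseteq> B)"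
proof
  assume "{X} \<preceq> max_sets S"
  then show "\<exists>B\<in>S. X \<subseteq> B" by (auto simp: singleton_le_iff max_sets_def)
next
  assume "\<exists>B\<in>S. X \<subseteq> B"
  then obtain B where B: "B \<in> S" "X \<subseteq> B" by blast
  obtain C where "C \<in> max_sets S" "B \<subseteq> C"
    using max_sets_dominates[OF assms B(1)] by blast
  with B(2) show "{X} \<preceq> max_sets S" by (auto simp: singleton_le_iff)
qed

text \<open>The order is inclusion of generated down-sets: for the converse it suffices to test the
  members of \<alpha>, which all lie below N.\<close>

lemma ac_le_iff_singleton_le:
  assumes "\<alpha> \<in> antichains N"
  shows "\<alpha> \<preceq> \<beta> \<longleftrightarrow> (\<forall>X\<subseteq>N. {X} \<preceq> \<alpha> \<longrightarrow> {X} \<preceq> \<beta>)"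
proof
  assume "\<alpha> \<preceq> \<beta>"
  then show "\<forall>X\<subseteq>N. {X} \<preceq> \<alpha> \<longrightarrow> {X} \<preceq> \<beta>"
    using ac_le_trans by blast
next
  assume h: "\<forall>X\<subseteq>N. {X} \<preceq> \<alpha> \<longrightarrow> {X} \<preceq> \<beta>"
  show "\<alpha> \<preceq> \<beta>" unfolding ac_le_def
  proof
    fix A assume A: "A \<in> \<alpha>"
    then have "A \<subseteq> N" using assms by (auto simp: antichains_def)
    moreover have "{A} \<preceq> \<alpha>" using A by (auto simp: singleton_le_iff)
    ultimately have "{A} \<preceq> \<beta>" using h by blast
    then show "\<exists>B\<in>\<beta>. A \<subseteq> B" by (simp add: singleton_le_iff)
  qed
qed

text \<open>Extensionality by down-sets, the form in which slicing and gluing are shown to be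
  mutually inverse.\<close>

lemma antichain_eqI:
  assumes "\<alpha> \<in> antichains N" "\<beta> \<in> antichains N"
    and "\<And>X. X \<subseteq> N \<Longrightarrow> {X} \<preceq> \<alpha> \<longleftrightarrow> {X} \<preceq> \<beta>"
  shows "\<alpha> = \<beta>"
  by (rule ac_le_antisym[OF assms(1,2)])
    (simp_all add: ac_le_iff_singleton_le[OF assms(1)] ac_le_iff_singleton_le[OF assms(2)] assms(3))

section \<open>Slicing along subsets of K, and gluing the slices back\<close>

definition antitone_families :: "'a set \<Rightarrow> 'i set \<Rightarrow> ('i set \<Rightarrow> 'a set set) set" where
  "antitone_families N K = {\<psi> \<in> Pow K \<rightarrow>\<^sub>E antichains N.
     \<forall>P P'. P \<subseteq> P' \<and> P' \<subseteq> K \<longrightarrow> \<psi> P' \<preceq> \<psi> P}"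

lemma antitone_familiesD:
  assumes "\<psi> \<in> antitone_families N K"
  shows "P \<subseteq> K \<Longrightarrow> \<psi> P \<in> antichains N"
    and "P \<subseteq> P' \<Longrightarrow> P' \<subseteq> K \<Longrightarrow> \<psi> P' \<preceq> \<psi> P"
  using assms unfolding antitone_families_def by (auto simp: PiE_iff)

definition slices :: "'a set \<Rightarrow> 'a set \<Rightarrow> 'a set set \<Rightarrow> 'a set \<Rightarrow> 'a set set" where
  "slices N K \<alpha> = (\<lambda>P\<in>Pow K. max_sets {A \<in> Pow N. {A \<union> P} \<preceq> \<alpha>})"

definition glue :: "'a set \<Rightarrow> 'a set \<Rightarrow> ('a set \<Rightarrow> 'a set set) \<Rightarrow> 'a set set" where
  "glue N K \<psi> = max_sets {X \<in> Pow (N \<union> K). {X \<inter> N} \<preceq> \<psi> (X \<inter> K)}"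

text \<open>The sets A with \<open>{A \<union> P} \<preceq> \<alpha>\<close> already form a
  down-set, so keeping only the maximal ones loses no information.\<close>

lemma singleton_le_slices_iff:
  assumes "finite N" "P \<subseteq> K" "A \<subseteq> N"
  shows "{A} \<preceq> slices N K \<alpha> P \<longleftrightarrow> {A \<union> P} \<preceq> \<alpha>"
proof -
  have "{A} \<preceq> slices N K \<alpha> P \<longleftrightarrow> (\<exists>B. B \<subseteq> N \<and> {B \<union> P} \<preceq> \<alpha> \<and> A \<subseteq> B)"
    using assms by (auto simp: slices_def singleton_le_max_sets_iff)
  also have "\<dots> \<longleftrightarrow> {A \<union> P} \<preceq> \<alpha>"
    using assms(3) singleton_le_mono[of _ \<alpha> "A \<union> P"] by blast
  finally show ?thesis .
qed

lemma slices_in_antitone_families: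
  assumes "finite N"
  shows "slices N K \<alpha> \<in> antitone_families N K"
proof -
  have closed: "slices N K \<alpha> P \<in> antichains N" if "P \<subseteq> K" for P
    using that by (auto simp: slices_def intro: max_sets_antichain)
  have "slices N K \<alpha> P' \<preceq> slices N K \<alpha> P" if "P \<subseteq> P'" "P' \<subseteq> K" for P P'
    unfolding ac_le_iff_singleton_le[OF closed[OF that(2)]]
  proof (intro allI impI)
    fix A assume A: "A \<subseteq> N" "{A} \<preceq> slices N K \<alpha> P'"
    then have "{A \<union> P'} \<preceq> \<alpha>" using singleton_le_slices_iff[OF assms that(2)] by blast
    then have "{A \<union> P} \<preceq> \<alpha>" by (rule singleton_le_mono) (use that in blast)
    then show "{A} \<preceq> slices N K \<alpha> P"
      using singleton_le_slices_iff[OF assms _ A(1), of P K] that by blast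
  qed
  moreover have "slices N K \<alpha> \<in> extensional (Pow K)"
    by (simp add: slices_def)
  ultimately show ?thesis
    using closed by (auto simp: antitone_families_def PiE_iff)
qed

lemma glue_in_antichains: "glue N K \<psi> \<in> antichains (N \<union> K)"
  unfolding glue_def by (rule max_sets_antichain) blast

text \<open>The sets collected in \<open>glue\<close> form a down-set: passing from Y to a subset X
  shrinks the N-part within the slice at \<open>Y \<inter> K\<close>, and antitonicity then moves it
  to the larger slice at \<open>X \<inter> K\<close>.\<close>

lemma singleton_le_glue_iff:
  assumes "finite N" "finite K" "\<psi> \<in> antitone_families N K" "X \<subseteq> N \<union> K"
  shows "{X} \<preceq> glue N K \<psi> \<longleftrightarrow> {X \<inter> N} \<preceq> \<psi> (X \<inter> K)"
proof -
  have "{X} \<preceq> glue N K \<psi> \<longleftrightarrow> (\<exists>Y \<subseteq> N \<union> K. {Y \<inter> N} \<preceq> \<psi> (Y \<inter> K) \<and> X \<subseteq> Y)"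
    using assms by (auto simp: glue_def singleton_le_max_sets_iff)
  also have "\<dots> \<longleftrightarrow> {X \<inter> N} \<preceq> \<psi> (X \<inter> K)"
  proof
    assume "\<exists>Y \<subseteq> N \<union> K. {Y \<inter> N} \<preceq> \<psi> (Y \<inter> K) \<and> X \<subseteq> Y"
    then obtain Y where Y: "{Y \<inter> N} \<preceq> \<psi> (Y \<inter> K)" "X \<subseteq> Y" by blast
    have "{X \<inter> N} \<preceq> \<psi> (Y \<inter> K)" by (rule singleton_le_mono[OF Y(1)]) (use Y(2) in blast)
    moreover have "\<psi> (Y \<inter> K) \<preceq> \<psi> (X \<inter> K)"
      by (rule antitone_familiesD(2)[OF assms(3)]) (use Y(2) in blast)+
    ultimately show "{X \<inter> N} \<preceq> \<psi> (X \<inter> K)" by (rule ac_le_trans)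
  qed (use assms(4) in blast)
  finally show ?thesis .
qed

lemma card_antichains_Un:
  assumes "finite N" "finite K" "N \<inter> K = {}"
  shows "card (antichains (N \<union> K)) = card (antitone_families N K)"
proof (rule bij_betw_same_card, rule bij_betwI)
  show "slices N K \<in> antichains (N \<union> K) \<rightarrow> antitone_families N K"
    using slices_in_antitone_families[OF assms(1)] by blast
  show "glue N K \<in> antitone_families N K \<rightarrow> antichains (N \<union> K)"
    using glue_in_antichains by blast
next
  fix \<alpha> assume \<alpha>: "\<alpha> \<in> antichains (N \<union> K)"
  show "glue N K (slices N K \<alpha>) = \<alpha>"
  proof (rule antichain_eqI[OF glue_in_antichains \<alpha>])
    fix X assume X: "X \<subseteq> N \<union> K"
    then have "X \<inter> N \<union> X \<inter> K = X" by blast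
    then show "{X} \<preceq> glue N K (slices N K \<alpha>) \<longleftrightarrow> {X} \<preceq> \<alpha>"
      using singleton_le_glue_iff[OF assms(1,2) slices_in_antitone_families[OF assms(1)] X]
      by (simp add: singleton_le_slices_iff assms(1))
  qed
next
  fix \<psi> assume \<psi>: "\<psi> \<in> antitone_families N K"
  show "slices N K (glue N K \<psi>) = \<psi>"
  proof
    fix P
    show "slices N K (glue N K \<psi>) P = \<psi> P"
    proof (cases "P \<subseteq> K")
      case True
      show ?thesis
      proof (rule antichain_eqI)
        show "slices N K (glue N K \<psi>) P \<in> antichains N"
          using antitone_familiesD(1)[OF slices_in_antitone_families[OF assms(1)]] True by blast
        show "\<psi> P \<in> antichains N" using antitone_familiesD(1)[OF \<psi> True] .
        fix A assume A: "A \<subseteq> N"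
        \<comment> \<open>Disjointness of N and K recovers A and P from their union.\<close>
        have "(A \<union> P) \<inter> N = A" "(A \<union> P) \<inter> K = P" "A \<union> P \<subseteq> N \<union> K"
          using A True assms(3) by blast+
        then show "{A} \<preceq> slices N K (glue N K \<psi>) P \<longleftrightarrow> {A} \<preceq> \<psi> P"
          using singleton_le_slices_iff[OF assms(1) True A]
            singleton_le_glue_iff[OF assms(1,2) \<psi>, of "A \<union> P"] by simp
      qed
    next
      \<comment> \<open>Off \<open>Pow K\<close> both sides are \<open>undefined\<close>, by
        extensionality.\<close>
      case False
      then show ?thesis using \<psi>
        by (auto simp: slices_def antitone_families_def PiE_iff extensional_def)
    qed
  qed
qed

section \<open>Freedom of the two extreme members of an antitone family\<close>

lemma ac_JOIN_cong: "(\<And>i. i \<in> I \<Longrightarrow> f i = g i) \<Longrightarrow> ac_JOIN I f = ac_JOIN I g"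
  unfolding ac_JOIN_def by (rule foldr_cong; cases "finite I") auto

lemma ac_MEET_cong: "(\<And>i. i \<in> I \<Longrightarrow> f i = g i) \<Longrightarrow> ac_MEET N I f = ac_MEET N I g"
  unfolding ac_MEET_def by (rule foldr_cong; cases "finite I") auto

abbreviation inner_meet :: "'a set \<Rightarrow> 'i::linorder set \<Rightarrow> ('i set \<Rightarrow> 'a set set) \<Rightarrow> 'a set set" where
  "inner_meet N K \<psi> \<equiv> ac_MEET N K (\<lambda>i. \<psi> (K - {i}))"

abbreviation inner_join :: "'i::linorder set \<Rightarrow> ('i set \<Rightarrow> 'a set set) \<Rightarrow> 'a set set" where
  "inner_join K \<psi> \<equiv> ac_JOIN K (\<lambda>i. \<psi> {i})"

text \<open>The tuples behind \<open>P_coeff\<close>, over arbitrary N and K, with \<alpha> for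
  \<open>\<rho>\<^sub>1\<close> and \<beta> for \<open>\<rho>\<^sub>2\<close>.\<close>

definition P_families ::
  "'a set \<Rightarrow> 'i::linorder set \<Rightarrow> 'a set set \<Rightarrow> 'a set set \<Rightarrow> ('i set \<Rightarrow> 'a set set) set" where
  "P_families N K \<alpha> \<beta> = {\<chi> \<in> antitone_families N K.
     \<chi> {} = \<beta> \<and> \<chi> K = \<alpha> \<and> inner_meet N K \<chi> = \<alpha> \<and> inner_join K \<chi> = \<beta>}"

lemma P_coeff_eq_card: "P_coeff n k \<alpha> \<beta> = card (P_families {1..n} {n+1..n+k} \<alpha> \<beta>)"
  unfolding P_coeff_def P_families_def antitone_families_def Let_def
  by (rule arg_cong[where f = card], rule Collect_cong) (simp add: conj_ac)

lemma finite_antitone_families: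
  assumes "finite N" "finite K"
  shows "finite (antitone_families N K)"
proof (rule finite_subset)
  show "antitone_families N K \<subseteq> Pow K \<rightarrow>\<^sub>E antichains N"
    unfolding antitone_families_def by blast
  show "finite (Pow K \<rightarrow>\<^sub>E antichains N)"
    using assms finite_antichains by (intro finite_PiE) auto
qed

text \<open>A proper subset P of K misses some i in K and so lies in \<open>K - {i}\<close>;
  antitonicity then puts \<open>\<psi> P\<close> above one of the members being met.\<close>

lemma inner_meet_le:
  assumes "finite N" "finite K" "\<psi> \<in> antitone_families N K"
  shows "inner_meet N K \<psi> \<in> antichains N"
    and "P \<subset> K \<Longrightarrow> inner_meet N K \<psi> \<preceq> \<psi> P"
    and "\<psi> K \<preceq> inner_meet N K \<psi>"
proof -
  have fam: "\<psi> (K - {i}) \<in> antichains N" for i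
    by (rule antitone_familiesD(1)[OF assms(3)]) blast
  note glb = ac_MEET_glb[of N K "\<lambda>i. \<psi> (K - {i})", OF assms(1,2) fam]
  show closed: "inner_meet N K \<psi> \<in> antichains N" by (rule glb(1))
  show "inner_meet N K \<psi> \<preceq> \<psi> P" if "P \<subset> K"
  proof -
    from that obtain i where i: "i \<in> K" "P \<subseteq> K - {i}" by blast
    have "inner_meet N K \<psi> \<preceq> \<psi> (K - {i})"
      using glb(2)[OF closed] ac_le_refl i(1) by blast
    moreover have "\<psi> (K - {i}) \<preceq> \<psi> P"
      by (rule antitone_familiesD(2)[OF assms(3) i(2)]) blast
    ultimately show ?thesis by (rule ac_le_trans)
  qed
  have "\<psi> K \<preceq> \<psi> (K - {i})" for i
    by (rule antitone_familiesD(2)[OF assms(3)]) blast+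
  then show "\<psi> K \<preceq> inner_meet N K \<psi>"
    using glb(2) antitone_familiesD(1)[OF assms(3) subset_refl] by blast
qed

text \<open>Dual argument: a nonempty P contains a singleton, whose member dominates
  \<open>\<psi> P\<close>.\<close>

lemma le_inner_join:
  assumes "finite N" "finite K" "\<psi> \<in> antitone_families N K"
  shows "inner_join K \<psi> \<in> antichains N"
    and "P \<noteq> {} \<Longrightarrow> P \<subseteq> K \<Longrightarrow> \<psi> P \<preceq> inner_join K \<psi>"
    and "inner_join K \<psi> \<preceq> \<psi> {}"
proof -
  have fam: "\<psi> {i} \<in> antichains N" if "i \<in> K" for i
    by (rule antitone_familiesD(1)[OF assms(3)]) (use that in blast)
  note lub = ac_JOIN_lub[of N K "\<lambda>i. \<psi> {i}", OF assms(1,2) fam]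
  show "inner_join K \<psi> \<in> antichains N" by (rule lub(1))
  show "\<psi> P \<preceq> inner_join K \<psi>" if P: "P \<noteq> {}" "P \<subseteq> K"
  proof -
    from P obtain i where i: "i \<in> K" "{i} \<subseteq> P" by blast
    have "\<psi> P \<preceq> \<psi> {i}" by (rule antitone_familiesD(2)[OF assms(3) i(2) P(2)])
    moreover have "\<psi> {i} \<preceq> inner_join K \<psi>"
      using lub(2) ac_le_refl i(1) by blast
    ultimately show ?thesis by (rule ac_le_trans)
  qed
  have "\<psi> {i} \<preceq> \<psi> {}" if "i \<in> K" for i
    by (rule antitone_familiesD(2)[OF assms(3)]) (use that in blast)+
  then show "inner_join K \<psi> \<preceq> \<psi> {}"
    using lub(2) by blast
qed

text \<open>With \<open>card K > 1\<close> a singleton \<open>{i}\<close> is both nonempty and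
  proper in K, so \<open>\<psi> {i}\<close> separates the two.\<close>

lemma inner_meet_le_inner_join:
  assumes "finite N" "finite K" "card K > 1" "\<psi> \<in> antitone_families N K"
  shows "inner_meet N K \<psi> \<preceq> inner_join K \<psi>"
proof -
  obtain i where i: "i \<in> K" using assms(3) by fastforce
  with assms(3) have "{i} \<subset> K" by auto
  then show ?thesis
    using inner_meet_le(2)[OF assms(1,2,4)] le_inner_join(2)[OF assms(1,2,4), of "{i}"]
      ac_le_trans by blast
qed

text \<open>For i in K, \<open>K - {i}\<close> differs from K and \<open>{i}\<close> from the empty
  set; \<open>card K > 1\<close> excludes \<open>K = {i}\<close>, and with it the two remaining
  coincidences.\<close>

lemma inner_update_extremes:
  assumes "card K > 1"
  shows "inner_meet N K (\<psi>(K := x, {} := y)) = inner_meet N K \<psi>"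
    and "inner_join K (\<psi>(K := x, {} := y)) = inner_join K \<psi>"
proof -
  have ne: "K \<noteq> {i}" for i using assms by auto
  show "inner_meet N K (\<psi>(K := x, {} := y)) = inner_meet N K \<psi>"
    by (rule ac_MEET_cong) (use ne in auto)
  show "inner_join K (\<psi>(K := x, {} := y)) = inner_join K \<psi>"
    by (rule ac_JOIN_cong) (use ne in auto)
qed

lemma update_extremes_in_antitone_families:
  assumes "finite N" "finite K" "card K > 1" "\<psi> \<in> antitone_families N K"
    and "x \<in> antichains N" "x \<preceq> inner_meet N K \<psi>"
    and "y \<in> antichains N" "inner_join K \<psi> \<preceq> y"
  shows "\<psi>(K := x, {} := y) \<in> antitone_families N K"
proof -
  let ?\<phi> = "\<psi>(K := x, {} := y)"
  have xy: "x \<preceq> y"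
    using inner_meet_le_inner_join[OF assms(1-4)] assms(6,8) ac_le_trans by blast
  have x: "x \<preceq> \<psi> P" if "P \<subset> K" for P
    using inner_meet_le(2)[OF assms(1,2,4) that] assms(6) ac_le_trans by blast
  have y: "\<psi> P \<preceq> y" if "P \<noteq> {}" "P \<subseteq> K" for P
    using le_inner_join(2)[OF assms(1,2,4) that] assms(8) ac_le_trans by blast
  \<comment> \<open>Cases by which ends of the pair are extreme: \<open>x\<close> handles only the
    upper index being K, \<open>y\<close> only the lower being empty, and \<open>xy\<close> both at
    once.\<close>
  have "?\<phi> P' \<preceq> ?\<phi> P" if "P \<subseteq> P'" "P' \<subseteq> K" for P P'
    using that xy x[of P] y[of P'] antitone_familiesD(2)[OF assms(4) that] ac_le_refl
    by auto
  moreover have "?\<phi> \<in> Pow K \<rightarrow>\<^sub>E antichains N"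
    using assms(4,5,7) by (auto simp: antitone_families_def PiE_iff extensional_def)
  ultimately show ?thesis by (simp add: antitone_families_def)
qed

section \<open>Counting antitone families by their inner meet and join\<close>

lemma card_antitone_families:
  assumes "finite N" "finite K" "card K > 1"
  shows "card (antitone_families N K) =
    (\<Sum>(\<alpha>, \<beta>) \<in> {(\<alpha>, \<beta>). \<alpha> \<in> antichains N \<and> \<beta> \<in> antichains N \<and> \<alpha> \<preceq> \<beta>}.
       card (ac_interval N ac_bot \<alpha>) * card (P_families N K \<alpha> \<beta>) *
       card (ac_interval N \<beta> (ac_top N)))"
proof -
  let ?I = "{(\<alpha>, \<beta>). \<alpha> \<in> antichains N \<and> \<beta> \<in> antichains N \<and> \<alpha> \<preceq> \<beta>}"
  let ?B = "\<lambda>(\<alpha>, \<beta>). (ac_interval N ac_bot \<alpha> \<times> P_families N K \<alpha> \<beta>) \<times> ac_interval N \<beta> (ac_top N)"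
  \<comment> \<open>\<open>?F\<close> records the inner meet and join, saves the original extreme
    members, and overwrites these in the family; \<open>?G\<close> puts the saved members
    back.\<close>
  let ?F = "\<lambda>\<psi>. ((inner_meet N K \<psi>, inner_join K \<psi>),
    (\<psi> K, \<psi>(K := inner_meet N K \<psi>, {} := inner_join K \<psi>)), \<psi> {})"
  let ?G = "\<lambda>(_, (x, \<chi>), y). \<chi>(K := x, {} := y)"
  have K: "K \<noteq> {}" using assms(3) by auto
  \<comment> \<open>The bounds \<open>ac_bot\<close> and \<open>ac_top N\<close> hold automatically,
    so each interval is exactly the set of admissible values for one extreme member.\<close>
  have below: "x \<in> ac_interval N ac_bot \<alpha> \<longleftrightarrow> x \<in> antichains N \<and> x \<preceq> \<alpha>" for x \<alpha>
    by (simp add: ac_interval_def ac_bot_def ac_le_def)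
  have above: "y \<in> ac_interval N \<beta> (ac_top N) \<longleftrightarrow> y \<in> antichains N \<and> \<beta> \<preceq> y" for y \<beta>
    by (auto simp: ac_interval_def ac_top_def ac_le_def antichains_def)
  have "bij_betw ?F (antitone_families N K) (Sigma ?I ?B)"
  proof (rule bij_betwI[where g = ?G])
    show "?F \<in> antitone_families N K \<rightarrow> Sigma ?I ?B"
    proof
      fix \<psi> assume \<psi>: "\<psi> \<in> antitone_families N K"
      note meet = inner_meet_le[OF assms(1,2) \<psi>] and join = le_inner_join[OF assms(1,2) \<psi>]
      have "\<psi>(K := inner_meet N K \<psi>, {} := inner_join K \<psi>) \<in> antitone_families N K"
        by (rule update_extremes_in_antitone_families[OF assms \<psi>])
          (simp_all add: meet join ac_le_refl)
      \<comment> \<open>The overwritten family keeps its inner meet and join, hence satisfies the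
        equations for this very pair; \<open>K \<noteq> {}\<close> prevents the second update from
        hiding the first.\<close>
      then have "\<psi>(K := inner_meet N K \<psi>, {} := inner_join K \<psi>)
          \<in> P_families N K (inner_meet N K \<psi>) (inner_join K \<psi>)"
        unfolding P_families_def mem_Collect_eq inner_update_extremes[OF assms(3)]
        using K by simp
      then show "?F \<psi> \<in> Sigma ?I ?B"
        using meet(1,3) join(1,3) inner_meet_le_inner_join[OF assms \<psi>]
          antitone_familiesD(1)[OF \<psi>] by (simp add: below above)
    qed
    show "?G \<in> Sigma ?I ?B \<rightarrow> antitone_families N K"
      using update_extremes_in_antitone_families[OF assms]
      by (auto simp: P_families_def below above)
    \<comment> \<open>The later updates at K and at the empty set cancel the earlier ones.\<close>
    show "?G (?F \<psi>) = \<psi>" for \<psi>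
      by (auto simp: fun_eq_iff)
    show "?F (?G t) = t" if t: "t \<in> Sigma ?I ?B" for t
    proof -
      obtain \<alpha> \<beta> x \<chi> y where t_eq: "t = ((\<alpha>, \<beta>), (x, \<chi>), y)"
        by (metis prod.exhaust)
      then have "\<chi> {} = \<beta>" "\<chi> K = \<alpha>" "inner_meet N K \<chi> = \<alpha>" "inner_join K \<chi> = \<beta>"
        using t by (auto simp: P_families_def)
      \<comment> \<open>The pair is read off unchanged after \<open>?G\<close>, and overwriting x
        and y by \<alpha> and \<beta> restores \<chi>, whose extreme members had those
        values.\<close>
      then show ?thesis
        unfolding t_eq prod.case inner_update_extremes[OF assms(3)]
        using K by (auto simp: fun_eq_iff)
    qed
  qed
  then have "card (antitone_families N K) = card (Sigma ?I ?B)"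
    by (rule bij_betw_same_card)
  also have "\<dots> = (\<Sum>p\<in>?I. card (?B p))"
  proof (rule card_SigmaI)
    show "finite ?I"
      by (rule finite_subset[of _ "antichains N \<times> antichains N"])
        (use finite_antichains[OF assms(1)] in auto)
    have "finite (ac_interval N \<alpha> \<beta>)" for \<alpha> \<beta>
      using finite_antichains[OF assms(1)] by (simp add: ac_interval_def)
    moreover have "finite (P_families N K \<alpha> \<beta>)" for \<alpha> \<beta>
      using finite_antitone_families[OF assms(1,2)] by (simp add: P_families_def)
    ultimately show "\<forall>p\<in>?I. finite (?B p)" by auto
  qed
  finally show ?thesis
    by (simp add: case_prod_beta card_cartesian_product)
qed

theorem theorem6p9:
  fixes n k :: nat
  assumes "k > 1"
  shows "card (antichains {1..n + k}) =
    (\<Sum>(\<alpha>, \<beta>) \<in> {(\<alpha>, \<beta>). \<alpha> \<in> antichains {1..n} \<and> \<beta> \<in> antichains {1..n} \<and> \<alpha> \<preceq> \<beta>}.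
       card (ac_interval {1..n} ac_bot \<alpha>) * P_coeff n k \<alpha> \<beta> *
       card (ac_interval {1..n} \<beta> (ac_top {1..n})))"
proof -
  have "{1..n + k} = {1..n} \<union> {n+1..n+k}" by auto
  then have "card (antichains {1..n + k}) = card (antitone_families {1..n} {n+1..n+k})"
    by (simp add: card_antichains_Un)
  also have "\<dots> = (\<Sum>(\<alpha>, \<beta>) \<in> {(\<alpha>, \<beta>). \<alpha> \<in> antichains {1..n} \<and> \<beta> \<in> antichains {1..n} \<and> \<alpha> \<preceq> \<beta>}.
       card (ac_interval {1..n} ac_bot \<alpha>) * P_coeff n k \<alpha> \<beta> *
       card (ac_interval {1..n} \<beta> (ac_top {1..n})))"
    unfolding P_coeff_eq_card by (rule card_antitone_families) (use assms in simp_all)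
  finally show ?thesis .
qed

end
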